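(* Consider $N=2$ non-interacting fermions on the square graph with $M=4$ vertices, with one-particle Hamiltonian $$h(s,t)=2I+\begin{pmatrix}s+t&-1&0&-1\\-1&-s+t&-1&0\\0&-1&-s-t&-1\\-1&0&-1&s-t\end{pmatrix},\qquad s,t\in\mathbb{R},$$ and two-particle Hamiltonian $H(s,t)=h(s,t)\otimes1+1\otimes h(s,t)$ on $\Lambda^2\mathbb{C}^4$. Let $\alpha(s)=-s+\sqrt{1+s^2}$. If $|s|>|t|$, then the ground state of $H(s,t)$ is non-degenerate with energy $4-2\sqrt{1+s^2}$ and is given by $$\Psi_A=\frac{1}{1+\alpha(s)^2}\,\big(0,\ \alpha(s),\ \alpha(s)^2,\ 1,\ \alpha(s),\ 0\big)$$ in the basis $(e_1\wedge e_2,\,e_1\wedge e_3,\,e_1\wedge e_4,\,e_2\wedge e_3,\,e_2\wedge e_4,\,e_3\wedge e_4)$, with density $$\rho_A=\frac{1}{1+\alpha(s)^2}\big(\alpha(s)^2,\,1,\,1,\,\alpha(s)^2\big),$$ both independent of $t$ as long as $|t|<|s|$. In particular, the non-degenerate ground state $\Psi_A$ and its density $\rho_A$, which satisfies $0<\rho_{A,i}<1$ on every vertex, are not uniquely $v$-representable, so the Hohenberg–Kohn theorem is violated.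
   Context: The external potential in $h(s,t)$ is $v=(s+t,-s+t,-s-t,s-t)$; the remaining part of $h$ is the negative graph Laplacian of the square graph with edges $1$–$2$, $2$–$3$, $3$–$4$, $4$–$1$. $e_1,\dots,e_4$ is the standard basis of $\mathbb{C}^4$. The density of a normalized $\Psi=\sum_{i<j}\Psi_{(i,j)}e_i\wedge e_j$ is $\rho_k=\sum_{(i,j)\ni k}|\Psi_{(i,j)}|^2$, where $\{e_i\wedge e_j\}_{i<j}$ is taken as an orthonormal basis of $\Lambda^2\mathbb{C}^4$. Writing $H=H_0+V$ with $V$ the operator of the external potential $v\in\mathbb{R}^4$ (i.e. $V(e_i\wedge e_j)=(v_i+v_j)e_i\wedge e_j$), a ground state of $H_0+V$ and its density are called uniquely $v$-representable if there is no potential $v'$, differing from $v$ by more than a constant vector, such that the same state is also a ground state of $H_0+V'$. The Hohenberg–Kohn theorem would state that two Hamiltonians $H_0+V$, $H_0+V'$ sharing a ground-state density must have $v-v'$ constant. *)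

theory Defs
  imports "HOL-Analysis.Analysis"
begin

section \<open>Tensor square, exterior square and two-particle operators\<close>

text \<open>
  The tensor square of \<open>\<complex>\<^sup>n\<close> is \<open>complex ^ ('n \<times> 'n)\<close>, and the exterior square is realised inside it
  as the subspace of antisymmetric tensors. With the factor \<open>1 / sqrt 2\<close> in \<open>wedge\<close>, the vectors
  \<open>wedge (e i) (e j)\<close>, one for each unordered pair, are orthonormal for the standard inner product.
\<close>

definition tensor_vec :: "complex ^ 'n \<Rightarrow> complex ^ 'n \<Rightarrow> complex ^ ('n::finite \<times> 'n)" where
  "tensor_vec u w = (\<chi> p. u $ fst p * w $ snd p)"

definition tensor_mat ::
  "complex ^ 'n ^ 'n \<Rightarrow> complex ^ 'n ^ 'n \<Rightarrow> complex ^ ('n \<times> 'n) ^ ('n::finite \<times> 'n)" where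
  "tensor_mat A B = (\<chi> p q. A $ fst p $ fst q * B $ snd p $ snd q)"

definition ext_square :: "(complex ^ ('n::finite \<times> 'n)) set" where
  "ext_square = {\<Psi>. \<forall>i j. \<Psi> $ (j, i) = - \<Psi> $ (i, j)}"

definition wedge :: "complex ^ 'n \<Rightarrow> complex ^ 'n \<Rightarrow> complex ^ ('n::finite \<times> 'n)" where
  "wedge u w = complex_of_real (1 / sqrt 2) *s (tensor_vec u w - tensor_vec w u)"

definition cinner_vec :: "complex ^ 'm \<Rightarrow> complex ^ 'm::finite \<Rightarrow> complex" where
  "cinner_vec u w = (\<Sum>p\<in>UNIV. cnj (u $ p) * w $ p)"

abbreviation e :: "'n \<Rightarrow> complex ^ 'n::finite" where
  "e i \<equiv> axis i 1"

definition two_particle :: "complex ^ 'n ^ 'n \<Rightarrow> complex ^ ('n \<times> 'n) ^ ('n::finite \<times> 'n)" where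
  "two_particle A = tensor_mat A (mat 1) + tensor_mat (mat 1) A"

section \<open>Ground states on the exterior square\<close>

text \<open>
  All operators considered are Hermitian, so only real eigenvalues are quantified over.
\<close>

definition eigenspace ::
  "complex ^ ('n \<times> 'n) ^ ('n \<times> 'n) \<Rightarrow> real \<Rightarrow> (complex ^ ('n::finite \<times> 'n)) set" where
  "eigenspace A E = {\<Psi> \<in> ext_square. A *v \<Psi> = complex_of_real E *s \<Psi>}"

definition eigenvalue :: "complex ^ ('n \<times> 'n) ^ ('n::finite \<times> 'n) \<Rightarrow> real \<Rightarrow> bool" where
  "eigenvalue A E \<longleftrightarrow> (\<exists>\<Psi> \<in> eigenspace A E. \<Psi> \<noteq> 0)"

definition ground_energy :: "complex ^ ('n \<times> 'n) ^ ('n::finite \<times> 'n) \<Rightarrow> real \<Rightarrow> bool" where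
  "ground_energy A E \<longleftrightarrow> eigenvalue A E \<and> (\<forall>E'. eigenvalue A E' \<longrightarrow> E \<le> E')"

definition ground_state ::
  "complex ^ ('n \<times> 'n) ^ ('n \<times> 'n) \<Rightarrow> complex ^ ('n::finite \<times> 'n) \<Rightarrow> bool" where
  "ground_state A \<Psi> \<longleftrightarrow> norm \<Psi> = 1 \<and> (\<exists>E. ground_energy A E \<and> \<Psi> \<in> eigenspace A E)"

definition nondegenerate :: "complex ^ ('n \<times> 'n) ^ ('n::finite \<times> 'n) \<Rightarrow> bool" where
  "nondegenerate A \<longleftrightarrow> (\<exists>E. ground_energy A E \<and> vec.dim (eigenspace A E) = 1)"

section \<open>The square graph\<close>

text \<open>
  The vertices are the elements \<open>1, 2, 3, 4\<close> of the type \<open>4\<close>. In that type \<open>4 = 0\<close>, so its built-in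
  order is not the order of the labels and the pairs \<open>i < j\<close> are therefore listed explicitly.
\<close>

definition pairs :: "(4 \<times> 4) set" where
  "pairs = {(1,2), (1,3), (1,4), (2,3), (2,4), (3,4)}"

definition coeff_wedge :: "complex ^ (4 \<times> 4) \<Rightarrow> 4 \<times> 4 \<Rightarrow> complex" where
  "coeff_wedge \<Psi> p = cinner_vec (wedge (e (fst p)) (e (snd p))) \<Psi>"

definition vertex_density :: "complex ^ (4 \<times> 4) \<Rightarrow> real ^ 4" where
  "vertex_density \<Psi> = (\<chi> k. \<Sum>p | p \<in> pairs \<and> (k = fst p \<or> k = snd p). (cmod (coeff_wedge \<Psi> p))\<^sup>2)"

definition in_wedge_basis ::
  "complex \<Rightarrow> complex \<Rightarrow> complex \<Rightarrow> complex \<Rightarrow> complex \<Rightarrow> complex \<Rightarrow> complex ^ (4 \<times> 4)" where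
  "in_wedge_basis c12 c13 c14 c23 c24 c34 =
     c12 *s wedge (e 1) (e 2) + c13 *s wedge (e 1) (e 3) + c14 *s wedge (e 1) (e 4) +
     c23 *s wedge (e 2) (e 3) + c24 *s wedge (e 2) (e 4) + c34 *s wedge (e 3) (e 4)"

definition square_edges :: "4 set set" where
  "square_edges = {{1,2}, {2,3}, {3,4}, {4,1}}"

definition neg_laplacian :: "complex ^ 4 ^ 4" where
  "neg_laplacian = (\<chi> i j. if i = j then of_nat (card {k. {i, k} \<in> square_edges})
                          else if {i, j} \<in> square_edges then -1 else 0)"

definition diag_mat :: "real ^ 4 \<Rightarrow> complex ^ 4 ^ 4" where
  "diag_mat v = (\<chi> i j. if i = j then complex_of_real (v $ i) else 0)"

definition H0 :: "complex ^ (4 \<times> 4) ^ (4 \<times> 4)" where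
  "H0 = two_particle neg_laplacian"

definition V :: "real ^ 4 \<Rightarrow> complex ^ (4 \<times> 4) ^ (4 \<times> 4)" where
  "V v = two_particle (diag_mat v)"

definition h :: "real \<Rightarrow> real \<Rightarrow> complex ^ 4 ^ 4" where
  "h s t = mat 2 + vector [
     vector [complex_of_real (s + t), -1, 0, -1],
     vector [-1, complex_of_real (- s + t), -1, 0],
     vector [0, -1, complex_of_real (- s - t), -1],
     vector [-1, 0, -1, complex_of_real (s - t)]]"

definition H :: "real \<Rightarrow> real \<Rightarrow> complex ^ (4 \<times> 4) ^ (4 \<times> 4)" where
  "H s t = two_particle (h s t)"

definition pot :: "real \<Rightarrow> real \<Rightarrow> real ^ 4" where
  "pot s t = vector [s + t, - s + t, - s - t, s - t]"

section \<open>Unique representability\<close>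

text \<open>
  The predicates below are meant for \<open>\<Psi>\<close> a ground state of \<open>H0 + V v\<close> and \<open>\<rho>\<close> its density. The
  density may also be reproduced by a different ground state of another potential.
\<close>

definition differ_by_constant :: "real ^ 4 \<Rightarrow> real ^ 4 \<Rightarrow> bool" where
  "differ_by_constant v v' \<longleftrightarrow> (\<exists>c. \<forall>i. v $ i - v' $ i = c)"

definition uniquely_v_representable_state :: "real ^ 4 \<Rightarrow> complex ^ (4 \<times> 4) \<Rightarrow> bool" where
  "uniquely_v_representable_state v \<Psi> \<longleftrightarrow>
     \<not> (\<exists>v'. \<not> differ_by_constant v v' \<and> ground_state (H0 + V v') \<Psi>)"

definition ground_state_density :: "real ^ 4 \<Rightarrow> real ^ 4 \<Rightarrow> bool" where
  "ground_state_density v \<rho> \<longleftrightarrow> (\<exists>\<Psi>. ground_state (H0 + V v) \<Psi> \<and> vertex_density \<Psi> = \<rho>)"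

definition uniquely_v_representable_density :: "real ^ 4 \<Rightarrow> real ^ 4 \<Rightarrow> bool" where
  "uniquely_v_representable_density v \<rho> \<longleftrightarrow>
     \<not> (\<exists>v'. \<not> differ_by_constant v v' \<and> ground_state_density v' \<rho>)"

definition hohenberg_kohn :: bool where
  "hohenberg_kohn \<longleftrightarrow>
     (\<forall>v v' \<rho>. ground_state_density v \<rho> \<and> ground_state_density v' \<rho> \<longrightarrow> differ_by_constant v v')"

section \<open>The explicit state and density\<close>

definition \<alpha> :: "real \<Rightarrow> real" where
  "\<alpha> s = - s + sqrt (1 + s\<^sup>2)"

definition \<Psi>A :: "real \<Rightarrow> complex ^ (4 \<times> 4)" where
  "\<Psi>A s = complex_of_real (1 / (1 + (\<alpha> s)\<^sup>2)) *s
     in_wedge_basis 0 (complex_of_real (\<alpha> s)) (complex_of_real ((\<alpha> s)\<^sup>2)) 1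
       (complex_of_real (\<alpha> s)) 0"

definition \<rho>A :: "real \<Rightarrow> real ^ 4" where
  "\<rho>A s = (1 / (1 + (\<alpha> s)\<^sup>2)) *\<^sub>R vector [(\<alpha> s)\<^sup>2, 1, 1, (\<alpha> s)\<^sup>2]"

section \<open>Consistency of the conventions\<close>

lemma vector_4_nth:
  "(vector [a, b, c, d] :: 'a::zero ^ 4) $ 1 = a"
  "(vector [a, b, c, d] :: 'a::zero ^ 4) $ 2 = b"
  "(vector [a, b, c, d] :: 'a::zero ^ 4) $ 3 = c"
  "(vector [a, b, c, d] :: 'a::zero ^ 4) $ 4 = d"
  by (simp_all add: vector_def)

lemma neg_laplacian_explicit:
  "neg_laplacian = vector [vector [2, -1, 0, -1], vector [-1, 2, -1, 0],
                           vector [0, -1, 2, -1], vector [-1, 0, -1, 2]]"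
proof -
  have edge: "{i, k} \<in> square_edges \<longleftrightarrow> k = i - 1 \<or> k = i + 1" for i k :: 4
  proof -
    have "\<forall>i k :: 4. {i, k} \<in> square_edges \<longleftrightarrow> k = i - 1 \<or> k = i + 1"
      unfolding square_edges_def insert_iff empty_iff doubleton_eq_iff forall_4 by simp
    thus ?thesis by blast
  qed
  have "\<forall>i :: 4. i - 1 \<noteq> i + 1"
    unfolding forall_4 by simp
  hence nb: "card {k. k = i - 1 \<or> k = i + 1} = 2" for i :: 4
    by (simp add: Collect_disj_eq)
  show ?thesis
    unfolding vec_eq_iff forall_4 neg_laplacian_def edge nb vec_lambda_beta vector_4_nth
    by simp
qed

lemma h_decomposition: "h s t = neg_laplacian + diag_mat (pot s t)"
  unfolding vec_eq_iff forall_4 h_def mat_def neg_laplacian_explicit diag_mat_def pot_def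
    vector_add_component vec_lambda_beta vector_4_nth
  by simp

lemma two_particle_add: "two_particle (A + B) = two_particle A + two_particle B"
  unfolding two_particle_def tensor_mat_def vec_eq_iff
  by (simp only: vector_add_component vec_lambda_beta distrib_left distrib_right add_ac) simp

lemma H_decomposition: "H s t = H0 + V (pot s t)"
  unfolding H_def H0_def V_def h_decomposition two_particle_add ..

lemma wedge_in_ext_square: "wedge u w \<in> ext_square"
  unfolding ext_square_def wedge_def tensor_vec_def by (simp add: right_diff_distrib mult.commute)

lemma tensor_mat_mult:
  "tensor_mat A B *v tensor_vec u w = tensor_vec (A *v u) (B *v w)"
proof -
  have "(\<Sum>p\<in>UNIV. A $ i $ fst p * B $ j $ snd p * (u $ fst p * w $ snd p)) =
        (\<Sum>k\<in>UNIV. A $ i $ k * u $ k) * (\<Sum>l\<in>UNIV. B $ j $ l * w $ l)" for i j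
    unfolding sum_product sum.cartesian_product UNIV_Times_UNIV
    by (rule sum.cong) (auto simp: mult_ac)
  thus ?thesis
    by (simp add: vec_eq_iff tensor_mat_def tensor_vec_def matrix_vector_mult_def)
qed

lemma two_particle_wedge:
  "two_particle A *v wedge u w = wedge (A *v u) w + wedge u (A *v w)"
  unfolding two_particle_def wedge_def matrix_vector_mult_add_rdistrib vec.scale vec.diff
    tensor_mat_mult matrix_vector_mul_lid vec.scale_right_distrib[symmetric]
  by (rule arg_cong[where f = "(*s) _"]) simp

lemma V_wedge:
  "V v *v wedge (e i) (e j) = complex_of_real (v $ i + v $ j) *s wedge (e i) (e j)"
proof -
  have "diag_mat v *v e k = complex_of_real (v $ k) *s e k" for k
  proof -
    have "diag_mat v $ i $ j * e k $ j = (if j = k then diag_mat v $ i $ k else 0)" for i j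
      by (simp add: axis_def)
    thus ?thesis
      by (auto simp: vec_eq_iff matrix_vector_mult_def diag_mat_def axis_def)
  qed
  thus ?thesis
    unfolding V_def two_particle_wedge
    by (simp add: wedge_def tensor_vec_def vec_eq_iff algebra_simps)
qed

lemma wedge_nth:
  "wedge (e i) (e j) $ (k, l) =
     complex_of_real (1 / sqrt 2) * (of_bool (k = i \<and> l = j) - of_bool (k = j \<and> l = i))"
  by (auto simp: wedge_def tensor_vec_def axis_def)

lemma cinner_wedge:
  "cinner_vec (wedge (e i) (e j)) \<Psi> = complex_of_real (1 / sqrt 2) * (\<Psi> $ (i, j) - \<Psi> $ (j, i))"
proof -
  let ?r = "complex_of_real (1 / sqrt 2)"
  have sum: "(\<Sum>p\<in>UNIV. of_bool (p = q) * \<Psi> $ p) = \<Psi> $ q" for q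
  proof -
    have "(\<Sum>p\<in>UNIV. of_bool (p = q) * \<Psi> $ p) = (\<Sum>p\<in>UNIV. if p = q then \<Psi> $ p else 0)"
      by (rule sum.cong) auto
    thus ?thesis by simp
  qed
  have "cnj (wedge (e i) (e j) $ p) * \<Psi> $ p =
      ?r * (of_bool (p = (i, j)) * \<Psi> $ p - of_bool (p = (j, i)) * \<Psi> $ p)" for p
  proof -
    obtain k l where p: "p = (k, l)" by fastforce
    have b: "cnj (of_bool P) = of_bool P" for P
      by (cases P) simp_all
    show ?thesis
      unfolding p wedge_nth prod.inject complex_cnj_mult complex_cnj_diff
        complex_cnj_complex_of_real b
      by (simp only: left_diff_distrib mult.assoc)
  qed
  hence "cinner_vec (wedge (e i) (e j)) \<Psi> =
      (\<Sum>p\<in>UNIV. ?r * (of_bool (p = (i, j)) * \<Psi> $ p - of_bool (p = (j, i)) * \<Psi> $ p))"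
    unfolding cinner_vec_def by (rule sum.cong[OF refl])
  thus ?thesis
    unfolding sum_distrib_left[symmetric] sum_subtractf sum .
qed

lemma wedge_orthonormal:
  "p \<in> pairs \<Longrightarrow> q \<in> pairs \<Longrightarrow>
     cinner_vec (wedge (e (fst p)) (e (snd p))) (wedge (e (fst q)) (e (snd q))) = of_bool (p = q)"
  (is "_ \<Longrightarrow> _ \<Longrightarrow> ?L p q = _")
proof -
  have r: "complex_of_real (1 / sqrt 2) * (complex_of_real (1 / sqrt 2) * x) = x / 2" for x
    by (simp flip: of_real_mult mult.assoc)
  have "\<forall>p\<in>pairs. \<forall>q\<in>pairs. ?L p q = of_bool (p = q)"
    unfolding cinner_wedge wedge_nth right_diff_distrib r
    by (simp add: pairs_def)
  thus "p \<in> pairs \<Longrightarrow> q \<in> pairs \<Longrightarrow> ?L p q = of_bool (p = q)"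
    by blast
qed

lemma wedge_expansion:
  assumes "\<Psi> \<in> ext_square"
  shows "\<Psi> = in_wedge_basis (coeff_wedge \<Psi> (1,2)) (coeff_wedge \<Psi> (1,3)) (coeff_wedge \<Psi> (1,4))
               (coeff_wedge \<Psi> (2,3)) (coeff_wedge \<Psi> (2,4)) (coeff_wedge \<Psi> (3,4))"
proof -
  have anti: "\<Psi> $ (j, i) = - \<Psi> $ (i, j)" for i j
    using assms unfolding ext_square_def by blast
  have diag: "\<Psi> $ (i, i) = 0" for i
  proof -
    have "\<Psi> $ (i, i) + \<Psi> $ (i, i) = 0"
      by (subst anti) (rule left_minus)
    thus ?thesis
      unfolding mult_2[symmetric] by simp
  qed
  have rr: "complex_of_real (1 / sqrt 2) * complex_of_real (1 / sqrt 2) = 1 / 2"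
    by (simp flip: of_real_mult)
  have c: "coeff_wedge \<Psi> (i, j) * wedge (e i) (e j) $ (k, l) =
        \<Psi> $ (i, j) * (of_bool (k = i \<and> l = j) - of_bool (k = j \<and> l = i))"
    (is "_ = _ * ?d") for i j k l
  proof -
    have d: "\<Psi> $ (i, j) - \<Psi> $ (j, i) = 2 * \<Psi> $ (i, j)"
      unfolding anti[of j i] diff_minus_eq_add mult_2 ..
    have "coeff_wedge \<Psi> (i, j) * wedge (e i) (e j) $ (k, l) =
        (complex_of_real (1 / sqrt 2) * complex_of_real (1 / sqrt 2)) * (2 * \<Psi> $ (i, j)) * ?d"
      unfolding coeff_wedge_def cinner_wedge wedge_nth fst_conv snd_conv d
      by (simp only: mult_ac)
    thus ?thesis
      unfolding rr by simp
  qed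
  note a = anti[of 2 1] anti[of 3 1] anti[of 4 1] anti[of 3 2] anti[of 4 2] anti[of 4 3]
  show ?thesis
    unfolding vec_eq_iff split_paired_All forall_4 in_wedge_basis_def vector_add_component
      vector_smult_component c diag a
    by simp
qed

end

(* The square graph is the product of two edges, so h(s,t) is a Kronecker sum of the two-level
   operators (s, -1; -1, -s) and (t, -1; -1, -t), with eigenvalues +-sqrt(1 + s^2) and
   +-sqrt(1 + t^2). For |s| > |t| both particles occupy the lower s-level, whose orbital has
   components proportional to (alpha(s), 1), and fill both t-levels, so that t drops out.
   On the exterior square this shows up as a splitting of H(s,t) - 4 into two 3x3 blocks of the
   same shape, one depending on s only and one on t only, with eigenvalues 0, +-2 sqrt(1 + s^2)
   and 0, +-2 sqrt(1 + t^2). *)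
theory Submission
  imports Defs
begin

section \<open>Entries of two-particle operators and of antisymmetric tensors\<close>

lemma sum_UNIV_prod:
  "(\<Sum>p\<in>UNIV. f p) = (\<Sum>i\<in>UNIV. \<Sum>j\<in>UNIV. f (i, j))"
  using sum.cartesian_product'[of f UNIV UNIV] by simp

text \<open>The identity factor in each summand collapses one index of the double sum.\<close>

lemma two_particle_nth:
  "(two_particle A *v \<Psi>) $ (i, j) =
     (\<Sum>k\<in>UNIV. A $ i $ k * \<Psi> $ (k, j)) + (\<Sum>k\<in>UNIV. A $ j $ k * \<Psi> $ (i, k))"
proof -
  have "(\<Sum>k\<in>UNIV. \<Sum>l\<in>UNIV. A $ i $ k * of_bool (j = l) * \<Psi> $ (k, l)) =
      (\<Sum>k\<in>UNIV. A $ i $ k * \<Psi> $ (k, j))"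
    by (intro sum.cong refl) (simp add: if_distrib if_distribR of_bool_def cong: if_cong)
  moreover have "(\<Sum>k\<in>UNIV. \<Sum>l\<in>UNIV. of_bool (i = k) * A $ j $ l * \<Psi> $ (k, l)) =
      (\<Sum>k\<in>UNIV. A $ j $ k * \<Psi> $ (i, k))"
    by (subst sum.swap, intro sum.cong refl)
      (simp add: if_distrib if_distribR of_bool_def cong: if_cong)
  ultimately show ?thesis
    unfolding two_particle_def matrix_vector_mult_def tensor_mat_def mat_def
    by (simp add: sum_UNIV_prod sum.distrib distrib_right of_bool_def)
qed

lemma ext_square_swap: "\<Psi> \<in> ext_square \<Longrightarrow> \<Psi> $ (j, i) = - \<Psi> $ (i, j)"
  unfolding ext_square_def by blast

lemma ext_squareI: "(\<And>i j. \<Psi> $ (j, i) = - \<Psi> $ (i, j)) \<Longrightarrow> \<Psi> \<in> ext_square"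
  unfolding ext_square_def by blast

lemma ext_square_diag:
  assumes "\<Psi> \<in> ext_square"
  shows "\<Psi> $ (i, i) = 0"
  using ext_square_swap[OF assms, of i i] by simp

lemma add_ext_square:
  assumes "\<Psi> \<in> ext_square" "\<Phi> \<in> ext_square"
  shows "\<Psi> + \<Phi> \<in> ext_square"
proof (rule ext_squareI)
  fix i j
  show "(\<Psi> + \<Phi>) $ (j, i) = - (\<Psi> + \<Phi>) $ (i, j)"
    using assms[THEN ext_square_swap, of j i] by simp
qed

lemma smult_ext_square:
  assumes "\<Psi> \<in> ext_square"
  shows "c *s \<Psi> \<in> ext_square"
proof (rule ext_squareI)
  fix i j
  show "(c *s \<Psi>) $ (j, i) = - (c *s \<Psi>) $ (i, j)"
    using ext_square_swap[OF assms, of j i] by simp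
qed

lemma h_nth:
  "h s t $ 1 $ 1 = 2 + of_real (s + t)" "h s t $ 1 $ 2 = -1" "h s t $ 1 $ 3 = 0" "h s t $ 1 $ 4 = -1"
  "h s t $ 2 $ 1 = -1" "h s t $ 2 $ 2 = 2 + of_real (- s + t)" "h s t $ 2 $ 3 = -1" "h s t $ 2 $ 4 = 0"
  "h s t $ 3 $ 1 = 0" "h s t $ 3 $ 2 = -1" "h s t $ 3 $ 3 = 2 + of_real (- s - t)" "h s t $ 3 $ 4 = -1"
  "h s t $ 4 $ 1 = -1" "h s t $ 4 $ 2 = 0" "h s t $ 4 $ 3 = -1" "h s t $ 4 $ 4 = 2 + of_real (s - t)"
  unfolding h_def mat_def vector_add_component vec_lambda_beta vector_4_nth by simp_all

text \<open>Antisymmetry fixes the diagonal and the reversed pairs, so an equation with sixteen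
  components reduces to six.\<close>

lemma ext_square_eq_iff:
  assumes "\<Psi> \<in> ext_square" "\<Phi> \<in> ext_square"
  shows "\<Psi> = \<Phi> \<longleftrightarrow> (\<forall>p\<in>pairs. \<Psi> $ p = \<Phi> $ p)"
proof
  assume eq: "\<forall>p\<in>pairs. \<Psi> $ p = \<Phi> $ p"
  have anti: "\<Psi> $ (j, i) = - \<Psi> $ (i, j)" "\<Phi> $ (j, i) = - \<Phi> $ (i, j)" for i j
    using assms by (blast intro: ext_square_swap)+
  have "\<forall>i j. \<Psi> $ (i, j) = \<Phi> $ (i, j)"
    unfolding forall_4 ext_square_diag[OF assms(1)] ext_square_diag[OF assms(2)]
      anti[of 2 1] anti[of 3 1] anti[of 4 1] anti[of 3 2] anti[of 4 2] anti[of 4 3]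
    using eq by (simp add: pairs_def)
  then show "\<Psi> = \<Phi>" by (simp add: vec_eq_iff)
qed simp

text \<open>Exchanging the indices swaps the two sums of \<open>two_particle_nth\<close>, each with
  a sign. With this, \<open>ext_square_eq_iff\<close> applies to both sides of the eigenvalue
  equation.\<close>

lemma two_particle_ext_square:
  assumes "\<Psi> \<in> ext_square"
  shows "two_particle A *v \<Psi> \<in> ext_square"
proof (rule ext_squareI)
  fix i j
  show "(two_particle A *v \<Psi>) $ (j, i) = - (two_particle A *v \<Psi>) $ (i, j)"
    unfolding two_particle_nth
    by (subst (1 2) ext_square_swap[OF assms]) (simp add: sum_negf)
qed

text \<open>The energy is measured from 4, the contribution of the term \<open>2I\<close> for two
  particles. Each block reads \<open>E p = -2 (x + y)\<close>, \<open>E x = 2 w x - p\<close>,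
  \<open>E y = -2 w y - p\<close>: first with \<open>w = s\<close> and \<open>p\<close> the sum of
  the entries \<open>(1,3)\<close> and \<open>(2,4)\<close>, then with \<open>w = t\<close> and
  \<open>p\<close> their difference. The sign put on the entry \<open>(3,4)\<close> gives both
  blocks literally the same shape.\<close>

lemma mem_eigenspace_H_iff:
  assumes "\<Psi> \<in> ext_square"
  shows "\<Psi> \<in> eigenspace (H s t) (4 + E) \<longleftrightarrow>
    (of_real E * (\<Psi> $ (1,3) + \<Psi> $ (2,4)) = - 2 * (\<Psi> $ (1,4) + \<Psi> $ (2,3)) \<and>
     of_real E * \<Psi> $ (1,4) = 2 * of_real s * \<Psi> $ (1,4) - (\<Psi> $ (1,3) + \<Psi> $ (2,4)) \<and>
     of_real E * \<Psi> $ (2,3) = - 2 * of_real s * \<Psi> $ (2,3) - (\<Psi> $ (1,3) + \<Psi> $ (2,4))) \<and>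
    (of_real E * (\<Psi> $ (1,3) - \<Psi> $ (2,4)) = - 2 * (\<Psi> $ (1,2) + - \<Psi> $ (3,4)) \<and>
     of_real E * \<Psi> $ (1,2) = 2 * of_real t * \<Psi> $ (1,2) - (\<Psi> $ (1,3) - \<Psi> $ (2,4)) \<and>
     of_real E * - \<Psi> $ (3,4) = - 2 * of_real t * - \<Psi> $ (3,4) - (\<Psi> $ (1,3) - \<Psi> $ (2,4)))"
    (is "_ \<longleftrightarrow> ?blocks")
proof -
  note anti = ext_square_swap[OF assms]
  \<comment> \<open>The only coupling between the blocks is in the equations for
    \<open>(1,3)\<close> and \<open>(2,4)\<close>; their sum and difference decouple it.\<close>
  have sum_diff: "a = b \<and> c = d \<longleftrightarrow> a + c = b + d \<and> a - c = b - d" for a b c d :: complex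
  proof
    assume "a + c = b + d \<and> a - c = b - d"
    then have "2 * a = 2 * b" by algebra
    with \<open>a + c = b + d \<and> a - c = b - d\<close> show "a = b \<and> c = d" by simp
  qed simp
  have "\<Psi> \<in> eigenspace (H s t) (4 + E) \<longleftrightarrow>
      (\<forall>p\<in>pairs. (H s t *v \<Psi>) $ p = (complex_of_real (4 + E) *s \<Psi>) $ p)"
    unfolding eigenspace_def H_def
      ext_square_eq_iff[OF two_particle_ext_square smult_ext_square, OF assms assms, symmetric]
    using assms by simp
  also have "\<dots> \<longleftrightarrow>
      of_real E * \<Psi> $ (1,2) = 2 * of_real t * \<Psi> $ (1,2) - (\<Psi> $ (1,3) - \<Psi> $ (2,4)) \<and>
      of_real E * \<Psi> $ (1,3) = - (\<Psi> $ (1,4) + \<Psi> $ (2,3)) - (\<Psi> $ (1,2) - \<Psi> $ (3,4)) \<and>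
      of_real E * \<Psi> $ (1,4) = 2 * of_real s * \<Psi> $ (1,4) - (\<Psi> $ (1,3) + \<Psi> $ (2,4)) \<and>
      of_real E * \<Psi> $ (2,3) = - 2 * of_real s * \<Psi> $ (2,3) - (\<Psi> $ (1,3) + \<Psi> $ (2,4)) \<and>
      of_real E * \<Psi> $ (2,4) = - (\<Psi> $ (1,4) + \<Psi> $ (2,3)) + (\<Psi> $ (1,2) - \<Psi> $ (3,4)) \<and>
      of_real E * - \<Psi> $ (3,4) = - 2 * of_real t * - \<Psi> $ (3,4) - (\<Psi> $ (1,3) - \<Psi> $ (2,4))"
    (is "_ \<longleftrightarrow> ?q12 \<and> ?q13 \<and> ?q14 \<and> ?q23 \<and> ?q24 \<and> ?q34")
    unfolding pairs_def ball_simps ball_empty H_def two_particle_nth sum_4 h_nth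
      ext_square_diag[OF assms] vector_smult_component of_real_add of_real_diff of_real_minus
      anti[of 2 1] anti[of 3 1] anti[of 4 1] anti[of 3 2] anti[of 4 2] anti[of 4 3] simp_thms
    by (intro conj_cong; simp; algebra)
  also have "\<dots> \<longleftrightarrow> (?q13 \<and> ?q24) \<and> ?q14 \<and> ?q23 \<and> ?q12 \<and> ?q34"
    by blast
  also have "\<dots> \<longleftrightarrow> ?blocks"
    \<comment> \<open>Fixing one left-hand side confines the rewriting to the intended pair of
      equations.\<close>
    unfolding sum_diff[of _ _ "of_real E * \<Psi> $ (2,4)"] by (simp add: algebra_simps) blast
  finally show ?thesis .
qed

text \<open>The characteristic polynomial of the block is \<open>E (E^2 - 4 (1 + w^2))\<close>, and
  the bound on \<open>E\<close> lies beyond all its roots.\<close>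

lemma block_trivial:
  fixes p x y :: complex and E w :: real
  assumes "of_real E * p = - 2 * (x + y)"
    and "of_real E * x = 2 * of_real w * x - p"
    and "of_real E * y = - 2 * of_real w * y - p"
    and "E\<^sup>2 > 4 * (1 + w\<^sup>2)"
  shows "p = 0 \<and> x = 0 \<and> y = 0"
proof -
  have "(2 * w)\<^sup>2 < E\<^sup>2"
    using assms(4) by (simp add: power_mult_distrib)
  then have "\<bar>2 * w\<bar> < \<bar>E\<bar>"
    using abs_le_square_iff[of E "2 * w"] by linarith
  then have E: "E \<noteq> 0" "E - 2 * w \<noteq> 0" "E + 2 * w \<noteq> 0" "E\<^sup>2 - 4 * (1 + w\<^sup>2) \<noteq> 0"
    using assms(4) by auto
  \<comment> \<open>Multiplying the first equation by \<open>(E - 2 w) (E + 2 w)\<close> and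
    inserting the other two eliminates \<open>x\<close> and \<open>y\<close>.\<close>
  have "of_real E * (of_real E ^ 2 - 4 * (1 + of_real w ^ 2)) * p = 0"
    using assms(1-3) by algebra
  then have "of_real (E * (E\<^sup>2 - 4 * (1 + w\<^sup>2))) * p = 0" by simp
  then have p: "p = 0" using E(1,4) unfolding mult_eq_0_iff of_real_eq_0_iff by blast
  have "of_real (E - 2 * w) * x = 0" "of_real (E + 2 * w) * y = 0"
    using assms(2,3) unfolding p of_real_diff of_real_add of_real_mult of_real_numeral
    by algebra+
  with p show ?thesis
    using E(2,3) unfolding mult_eq_0_iff of_real_eq_0_iff by blast
qed

section \<open>The explicit state, its norm and its density\<close>

lemma \<alpha>_pos: "\<alpha> s > 0"
proof -
  have "s \<le> \<bar>s\<bar>" by simp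
  also have "\<bar>s\<bar> < sqrt (1 + s\<^sup>2)" by (rule real_less_rsqrt) simp
  finally show ?thesis by (simp add: \<alpha>_def)
qed

text \<open>A difference of squares: \<open>sqrt (1 + s^2)\<close> squared minus \<open>s\<close>
  squared.\<close>

lemma \<alpha>_mult: "\<alpha> s * (s + sqrt (1 + s\<^sup>2)) = 1"
proof -
  have "(sqrt (1 + s\<^sup>2))\<^sup>2 = 1 + s\<^sup>2" by (simp add: add_nonneg_nonneg)
  then show ?thesis unfolding \<alpha>_def by algebra
qed

lemma \<Psi>A_ext_square: "\<Psi>A s \<in> ext_square"
  unfolding \<Psi>A_def in_wedge_basis_def
  by (intro smult_ext_square add_ext_square wedge_in_ext_square)

text \<open>These are tensor entries, not wedge coefficients, so \<open>c\<close> combines the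
  normalisation with the factor \<open>1 / sqrt 2\<close> of \<open>wedge\<close>.\<close>

lemma \<Psi>A_nth:
  fixes s :: real
  defines "c \<equiv> complex_of_real (1 / (1 + (\<alpha> s)\<^sup>2)) * complex_of_real (1 / sqrt 2)"
  shows "\<Psi>A s $ (1,2) = 0" "\<Psi>A s $ (1,3) = c * of_real (\<alpha> s)"
    "\<Psi>A s $ (1,4) = c * of_real ((\<alpha> s)\<^sup>2)" "\<Psi>A s $ (2,3) = c"
    "\<Psi>A s $ (2,4) = c * of_real (\<alpha> s)" "\<Psi>A s $ (3,4) = 0"
  unfolding \<Psi>A_def in_wedge_basis_def vector_smult_component vector_add_component wedge_nth c_def
  by simp_all

text \<open>Each pair is counted in both orders, which cancels the square of
  \<open>1 / sqrt 2\<close>; what remains is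
  \<open>\<alpha>^4 + 2 \<alpha>^2 + 1 = (1 + \<alpha>^2)^2\<close>.\<close>

lemma norm_\<Psi>A: "norm (\<Psi>A s) = 1"
proof -
  let ?n = "1 + (\<alpha> s)\<^sup>2"
  have pos: "?n > 0" by (simp add: add_pos_nonneg)
  note anti = ext_square_swap[OF \<Psi>A_ext_square[of s]]
  have "(\<Sum>p\<in>UNIV. (cmod (\<Psi>A s $ p))\<^sup>2) = (\<Sum>i\<in>UNIV. \<Sum>j\<in>UNIV. (cmod (\<Psi>A s $ (i, j)))\<^sup>2)"
    by (rule sum_UNIV_prod)
  also have "\<dots> = 2 * (2 * (\<alpha> s)\<^sup>2 + ((\<alpha> s)\<^sup>2)\<^sup>2 + 1) * (1 / ?n)\<^sup>2 * (1 / sqrt 2)\<^sup>2"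
    unfolding sum_4 ext_square_diag[OF \<Psi>A_ext_square[of s]]
      anti[of 2 1] anti[of 3 1] anti[of 4 1] anti[of 3 2] anti[of 4 2] anti[of 4 3]
      \<Psi>A_nth norm_mult norm_of_real norm_minus_cancel power_mult_distrib power2_abs
    by (simp add: algebra_simps)
  also have "\<dots> = ?n\<^sup>2 * (1 / ?n)\<^sup>2 * (2 * (1 / sqrt 2)\<^sup>2)"
    by algebra
  also have "\<dots> = 1"
    using pos by (simp add: power_divide)
  finally show ?thesis
    by (simp add: norm_vec_def L2_set_def)
qed

lemma vertex_density_\<Psi>A: "vertex_density (\<Psi>A s) = \<rho>A s"
proof -
  let ?n = "1 + (\<alpha> s)\<^sup>2"
  have pos: "?n > 0" by (simp add: add_pos_nonneg)
  \<comment> \<open>By antisymmetry a wedge coefficient is \<open>sqrt 2\<close> times the tensor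
    entry.\<close>
  have coeff: "(cmod (coeff_wedge (\<Psi>A s) (i, j)))\<^sup>2 = 2 * (cmod (\<Psi>A s $ (i, j)))\<^sup>2" for i j
  proof -
    have "\<Psi>A s $ (j, i) = - \<Psi>A s $ (i, j)"
      by (rule ext_square_swap[OF \<Psi>A_ext_square])
    then have "coeff_wedge (\<Psi>A s) (i, j) = of_real (2 / sqrt 2) * \<Psi>A s $ (i, j)"
      by (simp add: coeff_wedge_def cinner_wedge)
    then show ?thesis
      by (simp add: norm_mult norm_divide power_mult_distrib power_divide)
  qed
  have sel: "{p. p \<in> pairs \<and> (1 = fst p \<or> 1 = snd p)} = {(1,2), (1,3), (1,4)}"
    "{p. p \<in> pairs \<and> (2 = fst p \<or> 2 = snd p)} = {(1,2), (2,3), (2,4)}"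
    "{p. p \<in> pairs \<and> (3 = fst p \<or> 3 = snd p)} = {(1,3), (2,3), (3,4)}"
    "{p. p \<in> pairs \<and> (4 = fst p \<or> 4 = snd p)} = {(1,4), (2,4), (3,4)}"
    unfolding pairs_def by auto
  \<comment> \<open>Of the three pairs at a vertex one has coefficient zero; the other two give one
    of these sums, in which a factor \<open>1 + \<alpha>^2\<close> cancels.\<close>
  have sums: "(1 / ?n)\<^sup>2 * (\<alpha> s)\<^sup>2 + (1 / ?n)\<^sup>2 * ((\<alpha> s)\<^sup>2)\<^sup>2 = 1 / ?n * (\<alpha> s)\<^sup>2"
    "(1 / ?n)\<^sup>2 + (1 / ?n)\<^sup>2 * (\<alpha> s)\<^sup>2 = 1 / ?n"
  proof -
    have "1 / ?n * ?n = 1" using pos by simp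
    then show "(1 / ?n)\<^sup>2 * (\<alpha> s)\<^sup>2 + (1 / ?n)\<^sup>2 * ((\<alpha> s)\<^sup>2)\<^sup>2 = 1 / ?n * (\<alpha> s)\<^sup>2"
      "(1 / ?n)\<^sup>2 + (1 / ?n)\<^sup>2 * (\<alpha> s)\<^sup>2 = 1 / ?n"
      by algebra+
  qed
  have nth: "2 * (cmod (\<Psi>A s $ (1,2)))\<^sup>2 = 0" "2 * (cmod (\<Psi>A s $ (3,4)))\<^sup>2 = 0"
    "2 * (cmod (\<Psi>A s $ (1,3)))\<^sup>2 = (1 / ?n)\<^sup>2 * (\<alpha> s)\<^sup>2"
    "2 * (cmod (\<Psi>A s $ (2,4)))\<^sup>2 = (1 / ?n)\<^sup>2 * (\<alpha> s)\<^sup>2"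
    "2 * (cmod (\<Psi>A s $ (1,4)))\<^sup>2 = (1 / ?n)\<^sup>2 * ((\<alpha> s)\<^sup>2)\<^sup>2"
    "2 * (cmod (\<Psi>A s $ (2,3)))\<^sup>2 = (1 / ?n)\<^sup>2"
    unfolding \<Psi>A_nth norm_mult norm_of_real power_mult_distrib power2_abs
    by (simp_all add: power_divide)
  have set_sum: "(\<Sum>p\<in>{a, b, c}. f p) = f a + f b + f c" if "a \<noteq> b" "a \<noteq> c" "b \<noteq> c"
    for a b c :: "4 \<times> 4" and f :: "4 \<times> 4 \<Rightarrow> real"
    using that by (simp add: add.assoc)
  show ?thesis
    unfolding vec_eq_iff forall_4 vertex_density_def \<rho>A_def vec_lambda_beta sel
      vector_scaleR_component vector_4_nth
    using sums by (simp add: set_sum coeff nth add_ac)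
qed

section \<open>Eigenspaces and the ground state\<close>

lemma eigenspace_trivial:
  assumes "E\<^sup>2 > 4 * (1 + s\<^sup>2)" "E\<^sup>2 > 4 * (1 + t\<^sup>2)" and \<Psi>: "\<Psi> \<in> eigenspace (H s t) (4 + E)"
  shows "\<Psi> = 0"
proof -
  have ext: "\<Psi> \<in> ext_square" using \<Psi> by (simp add: eigenspace_def)
  note eqs = \<Psi>[unfolded mem_eigenspace_H_iff[OF ext]]
  have s: "\<Psi> $ (1,3) + \<Psi> $ (2,4) = 0 \<and> \<Psi> $ (1,4) = 0 \<and> \<Psi> $ (2,3) = 0"
    by (rule block_trivial[of E _ _ _ s]) (use eqs assms in blast)+
  have t: "\<Psi> $ (1,3) - \<Psi> $ (2,4) = 0 \<and> \<Psi> $ (1,2) = 0 \<and> - \<Psi> $ (3,4) = 0"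
    by (rule block_trivial[of E _ _ _ t]) (use eqs assms in blast)+
  from s t have "\<forall>p\<in>pairs. \<Psi> $ p = 0 $ p"
    by (simp add: pairs_def)
  then show ?thesis
    by (subst ext_square_eq_iff[OF ext]) (auto simp: ext_square_def)
qed

text \<open>The \<open>t\<close>-block vanishes identically on \<open>\<Psi>A s\<close>, so
  \<open>t\<close> never enters; the \<open>s\<close>-block holds by the defining relation of the
  square root. The energy is written to match the form \<open>4 + E\<close> of
  \<open>mem_eigenspace_H_iff\<close>.\<close>

lemma \<Psi>A_mem_eigenspace: "\<Psi>A s \<in> eigenspace (H s t) (4 + - 2 * sqrt (1 + s\<^sup>2))"
proof -
  let ?a = "sqrt (1 + s\<^sup>2)"
  have \<alpha>: "complex_of_real (\<alpha> s) = of_real ?a - of_real s"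
    by (simp add: \<alpha>_def)
  have "?a\<^sup>2 = 1 + s\<^sup>2" by (simp add: add_nonneg_nonneg)
  then have a: "(complex_of_real ?a)\<^sup>2 = 1 + (of_real s)\<^sup>2"
    by (metis of_real_1 of_real_add of_real_power)
  \<comment> \<open>An abstract \<open>c\<close> in place of the normalisation leaves polynomial
    identities modulo \<open>a\<close>.\<close>
  obtain c where c: "\<Psi>A s $ (1,2) = 0" "\<Psi>A s $ (1,3) = c * (of_real ?a - of_real s)"
    "\<Psi>A s $ (1,4) = c * (of_real ?a - of_real s)\<^sup>2" "\<Psi>A s $ (2,3) = c"
    "\<Psi>A s $ (2,4) = c * (of_real ?a - of_real s)" "\<Psi>A s $ (3,4) = 0"
    using \<Psi>A_nth[of s] unfolding of_real_power \<alpha> by blast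
  have E: "complex_of_real (- 2 * ?a) = - 2 * of_real ?a" by simp
  show ?thesis
    unfolding mem_eigenspace_H_iff[OF \<Psi>A_ext_square] c E by (intro conjI; (use a in algebra | simp add: algebra_simps))
qed

lemma eigenspace_ground:
  assumes "\<bar>s\<bar> > \<bar>t\<bar>"
  shows "eigenspace (H s t) (4 + - 2 * sqrt (1 + s\<^sup>2)) = vec.span {\<Psi>A s}"
proof
  let ?a = "sqrt (1 + s\<^sup>2)"
  show "vec.span {\<Psi>A s} \<subseteq> eigenspace (H s t) (4 + - 2 * ?a)"
  proof
    fix \<Psi> assume "\<Psi> \<in> vec.span {\<Psi>A s}"
    then obtain k where "\<Psi> = k *s \<Psi>A s" by (auto simp: vec.span_singleton)
    then show "\<Psi> \<in> eigenspace (H s t) (4 + - 2 * ?a)"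
      using \<Psi>A_mem_eigenspace[of s t]
      by (simp add: eigenspace_def smult_ext_square vec.scale mult.commute)
  qed
  show "eigenspace (H s t) (4 + - 2 * ?a) \<subseteq> vec.span {\<Psi>A s}"
  proof
    fix \<Psi> assume \<Psi>: "\<Psi> \<in> eigenspace (H s t) (4 + - 2 * ?a)"
    then have ext: "\<Psi> \<in> ext_square" by (simp add: eigenspace_def)
    note eqs = \<Psi>[unfolded mem_eigenspace_H_iff[OF ext]]
    have "t\<^sup>2 < s\<^sup>2" using assms abs_le_square_iff[of s t] by linarith
    \<comment> \<open>Here \<open>|t| < |s|\<close> enters: the energy lies outside the spectrum of
      the \<open>t\<close>-block, which must therefore vanish.\<close>
    then have "(- 2 * ?a)\<^sup>2 > 4 * (1 + t\<^sup>2)"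
      by (simp add: power_mult_distrib add_nonneg_nonneg)
    then have t: "\<Psi> $ (1,3) - \<Psi> $ (2,4) = 0 \<and> \<Psi> $ (1,2) = 0 \<and> - \<Psi> $ (3,4) = 0"
      by (intro block_trivial[of "- 2 * ?a" _ _ _ t]) (use eqs in blast)+
    have \<alpha>: "complex_of_real (\<alpha> s) = of_real ?a - of_real s"
      by (simp add: \<alpha>_def)
    have inv: "complex_of_real (\<alpha> s) * (of_real s + of_real ?a) = 1"
      using \<alpha>_mult[of s] by (metis of_real_add of_real_mult of_real_1)
    let ?c = "complex_of_real (1 / (1 + (\<alpha> s)\<^sup>2)) * complex_of_real (1 / sqrt 2)"
    have "(1 + (\<alpha> s)\<^sup>2) \<noteq> 0" using zero_le_power2[of "\<alpha> s"] by linarith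
    then have c: "?c \<noteq> 0"
      unfolding mult_eq_0_iff of_real_eq_0_iff by simp
    have E: "complex_of_real (- 2 * ?a) = - 2 * of_real ?a" by simp
    have p13: "\<Psi> $ (1,3) = \<Psi> $ (2,4)" using t by simp
    \<comment> \<open>The \<open>s\<close>-block now expresses every entry through the one at
      \<open>(2,3)\<close>, so the solution space is a line.\<close>
    have "2 * \<Psi> $ (2,4) = 2 * (of_real (\<alpha> s) * \<Psi> $ (2,3))"
      using eqs p13 unfolding \<alpha> E by algebra
    then have p24: "\<Psi> $ (2,4) = of_real (\<alpha> s) * \<Psi> $ (2,3)" by simp
    have "2 * \<Psi> $ (2,4) = 2 * ((of_real s + of_real ?a) * \<Psi> $ (1,4))"
      using eqs p13 unfolding E by algebra
    then have "\<Psi> $ (2,4) = (of_real s + of_real ?a) * \<Psi> $ (1,4)" by simp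
    then have p14: "\<Psi> $ (1,4) = (of_real (\<alpha> s))\<^sup>2 * \<Psi> $ (2,3)"
      using inv p24 by algebra
    \<comment> \<open>The entry of \<open>\<Psi>A s\<close> at \<open>(2,3)\<close> is
      \<open>?c\<close>, which dictates the scalar.\<close>
    have "\<Psi> = (\<Psi> $ (2,3) / ?c) *s \<Psi>A s"
    proof (subst ext_square_eq_iff[OF ext smult_ext_square[OF \<Psi>A_ext_square]])
      show "\<forall>p\<in>pairs. \<Psi> $ p = ((\<Psi> $ (2,3) / ?c) *s \<Psi>A s) $ p"
        unfolding pairs_def ball_simps vector_smult_component \<Psi>A_nth
        using t c p24 p13 p14 by (simp add: field_simps)
    qed
    then show "\<Psi> \<in> vec.span {\<Psi>A s}"
      by (auto simp: vec.span_singleton)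
  qed
qed

text \<open>For a smaller \<open>E\<close>, the square of \<open>E - 4\<close> exceeds
  \<open>4 (1 + s^2)\<close> and hence \<open>4 (1 + t^2)\<close>, so both blocks are
  trivial.\<close>

lemma ground_energy_H:
  assumes "\<bar>s\<bar> > \<bar>t\<bar>"
  shows "ground_energy (H s t) (4 + - 2 * sqrt (1 + s\<^sup>2))"
proof -
  let ?a = "sqrt (1 + s\<^sup>2)"
  have "\<Psi>A s \<noteq> 0" using norm_\<Psi>A[of s] by auto
  moreover have "4 + - 2 * ?a \<le> E" if "eigenvalue (H s t) E" for E
  proof (rule ccontr)
    assume "\<not> 4 + - 2 * ?a \<le> E"
    then have "2 * ?a < 4 - E" by simp
    then have "(2 * ?a)\<^sup>2 < (4 - E)\<^sup>2"
      by (rule power_strict_mono) (auto simp: add_nonneg_nonneg)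
    then have "4 * (1 + s\<^sup>2) < (E - 4)\<^sup>2"
      by (simp add: power_mult_distrib add_nonneg_nonneg power2_commute)
    moreover have "t\<^sup>2 < s\<^sup>2" using assms abs_le_square_iff[of s t] by linarith
    ultimately have "\<Psi> = 0" if "\<Psi> \<in> eigenspace (H s t) E" for \<Psi>
      using eigenspace_trivial[of s "E - 4" t \<Psi>] that by simp
    with that show False by (auto simp: eigenvalue_def)
  qed
  ultimately show ?thesis
    using \<Psi>A_mem_eigenspace[of s t] unfolding ground_energy_def eigenvalue_def by blast
qed

lemma ground_state_\<Psi>A: "\<bar>s\<bar> > \<bar>t\<bar> \<Longrightarrow> ground_state (H s t) (\<Psi>A s)"
  using ground_energy_H \<Psi>A_mem_eigenspace norm_\<Psi>A unfolding ground_state_def by blast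

section \<open>Different potentials with a common ground state\<close>

lemma differ_by_constant_pot_iff: "differ_by_constant (pot s t) (pot s t') \<longleftrightarrow> t = t'"
  \<comment> \<open>The difference of the potentials is
    \<open>(t - t') (1, 1, -1, -1)\<close>.\<close>
  unfolding differ_by_constant_def pot_def forall_4 vector_4_nth by auto

lemma \<rho>A_bounds: "0 < \<rho>A s $ i \<and> \<rho>A s $ i < 1"
proof -
  have "(\<alpha> s)\<^sup>2 > 0" "1 + (\<alpha> s)\<^sup>2 > 0"
    using \<alpha>_pos[of s] by (simp_all add: add_pos_pos)
  then have "\<forall>i. 0 < \<rho>A s $ i \<and> \<rho>A s $ i < 1"
    unfolding forall_4 \<rho>A_def vector_scaleR_component vector_4_nth
    by (simp add: divide_simps del: zero_less_power2)
  then show ?thesis by blast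
qed

theorem mainTheorem7:
  fixes s t :: real
  assumes "\<bar>s\<bar> > \<bar>t\<bar>"
  shows "nondegenerate (H s t) \<and>
    ground_energy (H s t) (4 - 2 * sqrt (1 + s\<^sup>2)) \<and>
    ground_state (H s t) (\<Psi>A s) \<and>
    vertex_density (\<Psi>A s) = \<rho>A s \<and>
    (\<forall>i. 0 < \<rho>A s $ i \<and> \<rho>A s $ i < 1) \<and>
    \<not> uniquely_v_representable_state (pot s t) (\<Psi>A s) \<and>
    \<not> uniquely_v_representable_density (pot s t) (\<rho>A s) \<and>
    \<not> hohenberg_kohn"
proof -
  \<comment> \<open>The midpoint of \<open>t\<close> and \<open>|s|\<close> differs from
    \<open>t\<close> and stays strictly between \<open>-|s|\<close> and \<open>|s|\<close>.\<close>
  define t' where "t' = (\<bar>s\<bar> + t) / 2"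
  have t': "\<bar>s\<bar> > \<bar>t'\<bar>" "t \<noteq> t'"
    using assms by (auto simp: t'_def)
  have differ: "\<not> differ_by_constant (pot s t) (pot s t')"
    using t'(2) by (simp add: differ_by_constant_pot_iff)
  have gs: "ground_state (H0 + V (pot s \<tau>)) (\<Psi>A s)" if "\<bar>s\<bar> > \<bar>\<tau>\<bar>" for \<tau>
    using ground_state_\<Psi>A[OF that] by (simp add: H_decomposition)
  then have density: "ground_state_density (pot s \<tau>) (\<rho>A s)" if "\<bar>s\<bar> > \<bar>\<tau>\<bar>" for \<tau>
    using that vertex_density_\<Psi>A unfolding ground_state_density_def by blast
  have "\<Psi>A s \<noteq> 0" using norm_\<Psi>A[of s] by auto
  then have "vec.dim (eigenspace (H s t) (4 + - 2 * sqrt (1 + s\<^sup>2))) = 1"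
    by (simp only: eigenspace_ground[OF assms] vec.dim_span vec.dim_singleton if_False)
  then have "nondegenerate (H s t)"
    using ground_energy_H[OF assms] unfolding nondegenerate_def by blast
  moreover have "ground_energy (H s t) (4 - 2 * sqrt (1 + s\<^sup>2))"
    using ground_energy_H[OF assms] by simp
  moreover have "\<not> uniquely_v_representable_state (pot s t) (\<Psi>A s)"
    unfolding uniquely_v_representable_state_def using differ gs[OF t'(1)] by blast
  moreover have "\<not> uniquely_v_representable_density (pot s t) (\<rho>A s)"
    unfolding uniquely_v_representable_density_def using differ density[OF t'(1)] by blast
  moreover have "\<not> hohenberg_kohn"
    unfolding hohenberg_kohn_def using differ density[OF assms] density[OF t'(1)] by blast
  ultimately show ?thesis
    using ground_state_\<Psi>A[OF assms] vertex_density_\<Psi>A \<rho>A_bounds by blast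
qed

end
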